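(* Let $f:X\to Y$ be a continuous map and let $B\subseteq X$. Then $TC^S(f,B)\le TC^S(f)$.
   Context: For a topological space $Y$, $PY=Y^I$ is the space of continuous paths $[0,1]\to Y$ with the compact-open topology, and for $C\subseteq Y$, $P_{Y\times C}=\{\gamma\in PY:\gamma(1)\in C\}$. For a continuous map $f:X\to Y$ and $B\subseteq X$, $TC^S(f,B)$ is the least integer $n\ge0$ such that $X\times B$ has an open cover $U_0,\dots,U_n$ with, for each $i$, a continuous map $\sigma_i:U_i\to P_{Y\times f(B)}$ satisfying $\sigma_i(x,b)(0)=f(x)$ and $\sigma_i(x,b)(1)=f(b)$; it is $\infty$ if there is no such cover. $TC^S(f)$ is the least integer $k\ge 0$ such that $X\times X$ has an open cover $U_0,\dots,U_k$ with, for each $i$, a continuous map $f_i:U_i\to Y^I$ satisfying $f_i(x_0,x_1)(0)=f(x_0)$ and $f_i(x_0,x_1)(1)=f(x_1)$ ($\infty$ if there is none). *)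

theory Defs
  imports "HOL-Analysis.Analysis" "HOL-Library.Extended_Nat"
begin

text \<open>
  Spaces are values of type \<open>'a topology\<close>. A path is a continuous map on \<open>{0..1}\<close>, made unique
  as a HOL function by requiring it to be \<open>undefined\<close> outside \<open>{0..1}\<close>.
\<close>

definition paths :: "'a topology \<Rightarrow> (real \<Rightarrow> 'a) set" where
  "paths Y = {\<gamma> \<in> extensional {0..1}. pathin Y \<gamma>}"

text \<open>The compact-open topology. Taking \<open>K = {}\<close> shows that its carrier is all of \<open>paths Y\<close>.\<close>

definition path_space :: "'a topology \<Rightarrow> (real \<Rightarrow> 'a) topology" where
  "path_space Y = topology_generated_by
     {{\<gamma> \<in> paths Y. \<gamma> ` K \<subseteq> W} | K W.
        compactin (top_of_set {0..1}) K \<and> openin Y W}"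

lemma topspace_path_space [simp]: "topspace (path_space Y) = paths Y"
proof -
  have "paths Y = {\<gamma> \<in> paths Y. \<gamma> ` {} \<subseteq> {}}"
    by auto
  then have "paths Y \<in> {{\<gamma> \<in> paths Y. \<gamma> ` K \<subseteq> W} | K W.
      compactin (top_of_set {0..1}) K \<and> openin Y W}"
    using compactin_empty openin_empty by blast
  then show ?thesis
    unfolding path_space_def topology_generated_by_topspace by blast
qed

definition path_space_to :: "'a topology \<Rightarrow> 'a set \<Rightarrow> (real \<Rightarrow> 'a) topology" where
  "path_space_to Y C = subtopology (path_space Y) {\<gamma>. \<gamma> 1 \<in> C}"

text \<open>
  In both definitions below the infimum is taken in \<^typ>\<open>enat\<close>: it is the least element of a
  nonempty set, and \<open>\<infinity>\<close> for the empty set.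
\<close>

definition TCS_rel :: "'a topology \<Rightarrow> 'b topology \<Rightarrow> ('a \<Rightarrow> 'b) \<Rightarrow> 'a set \<Rightarrow> enat" where
  "TCS_rel X Y f B = Inf {enat n | n. \<exists>U :: nat \<Rightarrow> ('a \<times> 'a) set.
     (\<forall>i\<le>n. openin (prod_topology X (subtopology X B)) (U i)) \<and>
     (\<Union>i\<le>n. U i) = topspace (prod_topology X (subtopology X B)) \<and>
     (\<forall>i\<le>n. \<exists>\<sigma>.
        continuous_map (subtopology (prod_topology X (subtopology X B)) (U i))
          (path_space_to Y (f ` B)) \<sigma> \<and>
        (\<forall>(x, b) \<in> U i. \<sigma> (x, b) 0 = f x \<and> \<sigma> (x, b) 1 = f b))}"

definition TCS :: "'a topology \<Rightarrow> 'b topology \<Rightarrow> ('a \<Rightarrow> 'b) \<Rightarrow> enat" where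
  "TCS X Y f = Inf {enat k | k. \<exists>U :: nat \<Rightarrow> ('a \<times> 'a) set.
     (\<forall>i\<le>k. openin (prod_topology X X) (U i)) \<and>
     (\<Union>i\<le>k. U i) = topspace (prod_topology X X) \<and>
     (\<forall>i\<le>k. \<exists>\<sigma>.
        continuous_map (subtopology (prod_topology X X) (U i)) (path_space Y) \<sigma> \<and>
        (\<forall>(x0, x1) \<in> U i. \<sigma> (x0, x1) 0 = f x0 \<and> \<sigma> (x0, x1) 1 = f x1))}"

end

theory Submission
  imports Defs
begin

text \<open>
  A motion planner on an open set \<open>U \<subseteq> X \<times> X\<close> restricts to \<open>U \<inter> (X \<times> B)\<close>. Over this smaller set
  the planned paths end at points \<open>f b\<close> with \<open>b \<in> B\<close>, so the restricted planner takes values in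
  the subspace of paths ending in \<open>f ` B\<close>, and it stays continuous because that space has the
  subspace topology. Restricting a whole cover thus keeps its size: every size admissible for
  \<^term>\<open>TCS X Y f\<close> is admissible for \<^term>\<open>TCS_rel X Y f B\<close>, and the infimum over the larger set
  of sizes is the smaller one. The only point of topology is that the product of \<open>X\<close> with the
  subspace \<open>B\<close> is a subspace of \<open>X \<times> X\<close>.
\<close>

lemma prod_topology_subtopology_snd:
  "prod_topology X (subtopology Y B) = subtopology (prod_topology X Y) (UNIV \<times> B)"
  using subtopology_Times[of X Y UNIV B] by simp

text \<open>
  Continuity into the path space with constrained endpoints comes down to two checks: continuity
  into the full path space, inherited from the larger domain, and the endpoint condition, which
  holds because the second coordinate lies in \<open>B\<close>.
\<close>

lemma continuous_map_restrict_planner: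
  assumes cont: "continuous_map (subtopology (prod_topology X X) U) (path_space Y) \<sigma>"
    and ends: "\<forall>(x, b) \<in> U. \<sigma> (x, b) 0 = f x \<and> \<sigma> (x, b) 1 = f b"
  shows "continuous_map
    (subtopology (prod_topology X (subtopology X B)) (U \<inter> (UNIV \<times> B)))
    (path_space_to Y (f ` B)) \<sigma>"
  unfolding path_space_to_def
proof (rule continuous_map_into_subtopology)
  show "continuous_map
      (subtopology (prod_topology X (subtopology X B)) (U \<inter> (UNIV \<times> B))) (path_space Y) \<sigma>"
    unfolding prod_topology_subtopology_snd subtopology_subtopology
    by (rule continuous_map_from_subtopology_mono[OF cont]) auto
  show "\<sigma> \<in> topspace
      (subtopology (prod_topology X (subtopology X B)) (U \<inter> (UNIV \<times> B))) \<rightarrow> {\<gamma>. \<gamma> 1 \<in> f ` B}"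
    using ends by fastforce
qed

theorem proposition5p2:
  fixes X :: "'a topology" and Y :: "'b topology" and f :: "'a \<Rightarrow> 'b" and B :: "'a set"
  assumes "continuous_map X Y f" and "B \<subseteq> topspace X"
  shows "TCS_rel X Y f B \<le> TCS X Y f"
  unfolding TCS_rel_def TCS_def
proof (rule Inf_superset_mono, safe)
  fix k and U :: "nat \<Rightarrow> ('a \<times> 'a) set"
  let ?Z = "prod_topology X (subtopology X B)"
  assume op: "\<forall>i\<le>k. openin (prod_topology X X) (U i)"
    and cov: "(\<Union>i\<le>k. U i) = topspace (prod_topology X X)"
    and plan: "\<forall>i\<le>k. \<exists>\<sigma>.
      continuous_map (subtopology (prod_topology X X) (U i)) (path_space Y) \<sigma> \<and>
      (\<forall>(x0, x1) \<in> U i. \<sigma> (x0, x1) 0 = f x0 \<and> \<sigma> (x0, x1) 1 = f x1)"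
  define V where "V i = U i \<inter> (UNIV \<times> B)" for i
  have "\<forall>i\<le>k. openin ?Z (V i)"
    using op unfolding V_def prod_topology_subtopology_snd openin_subtopology by blast
  moreover have "(\<Union>i\<le>k. V i) = topspace ?Z"
    using cov unfolding V_def prod_topology_subtopology_snd topspace_subtopology by blast
  moreover have "\<forall>i\<le>k. \<exists>\<sigma>.
      continuous_map (subtopology ?Z (V i)) (path_space_to Y (f ` B)) \<sigma> \<and>
      (\<forall>(x, b) \<in> V i. \<sigma> (x, b) 0 = f x \<and> \<sigma> (x, b) 1 = f b)"
  proof (intro allI impI)
    fix i assume "i \<le> k"
    with plan obtain \<sigma>
      where \<sigma>: "continuous_map (subtopology (prod_topology X X) (U i)) (path_space Y) \<sigma>"
        and ends: "\<forall>(x, b) \<in> U i. \<sigma> (x, b) 0 = f x \<and> \<sigma> (x, b) 1 = f b"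
      by blast
    have "continuous_map (subtopology ?Z (V i)) (path_space_to Y (f ` B)) \<sigma>"
      unfolding V_def by (rule continuous_map_restrict_planner[OF \<sigma> ends])
    moreover have "\<forall>(x, b) \<in> V i. \<sigma> (x, b) 0 = f x \<and> \<sigma> (x, b) 1 = f b"
      using ends unfolding V_def by blast
    ultimately show "\<exists>\<sigma>.
        continuous_map (subtopology ?Z (V i)) (path_space_to Y (f ` B)) \<sigma> \<and>
        (\<forall>(x, b) \<in> V i. \<sigma> (x, b) 0 = f x \<and> \<sigma> (x, b) 1 = f b)"
      by blast
  qed
  ultimately show "\<exists>n. enat k = enat n \<and> (\<exists>U :: nat \<Rightarrow> ('a \<times> 'a) set.
      (\<forall>i\<le>n. openin ?Z (U i)) \<and>
      (\<Union>i\<le>n. U i) = topspace ?Z \<and>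
      (\<forall>i\<le>n. \<exists>\<sigma>. continuous_map (subtopology ?Z (U i)) (path_space_to Y (f ` B)) \<sigma> \<and>
        (\<forall>(x, b) \<in> U i. \<sigma> (x, b) 0 = f x \<and> \<sigma> (x, b) 1 = f b)))"
    by blast
qed

end
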